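(* Let $a,b:[0,\infty)\to\mathbb{R}$ be positive continuous functions, let $g:[0,\infty)\to\mathbb{R}$ be continuous and nonnegative, and let $x_0>0$. Let $Y$ be the solution of $$\frac{dY_t}{dt}=a(t)\,b(Y_t+g(t)),\quad t>0,\qquad Y_0=x_0,$$ with time of explosion $T_e$, and suppose that $Y$ maps $[0,T_e)$ onto $[x_0,\infty)$, with inverse $Y^{-1}:[x_0,\infty)\to[0,T_e)$. Then $Y$ can be expressed as $$Y_t=\overline{B}^{\,-1}(A(t))\quad\text{for every } t<A^{-1}(\overline{B}(\infty)).$$
   Context: $A:[0,\infty)\to\mathbb{R}$ is $A(t)=\int_0^t a(s)\,ds$, and $\overline{B}:[x_0,\infty)\to\mathbb{R}$ is $$\overline{B}(y)=\int_{x_0}^y\frac{ds}{b\bigl(s+g(Y^{-1}(s))\bigr)}.$$ Both are continuous and strictly increasing; $A(\infty)$ and $\overline{B}(\infty)$ denote their limits at $\infty$ in $(0,\infty]$. Convention: $A^{-1}(s)=\infty$ if $s\ge A(\infty)$. The solution $Y$ is a maximal solution, assigned the value $\infty$ from the moment it becomes infinite; $T_e=\sup\{t\ge0:Y_t<\infty\}\in[0,\infty]$. On $[0,T_e)$, $Y$ is continuous and strictly increasing. *)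

theory Defs
  imports "HOL-Analysis.Analysis"
begin

text \<open>
  \<open>y\<close> solves the initial value problem on \<open>[0, T)\<close>, where \<open>T\<close> may be infinite. As \<open>b\<close> is only
  meaningful on \<open>[0, \<infinity>)\<close>, being a solution includes that the argument of \<open>b\<close> stays in this set.
\<close>

definition solves_on ::
  "(real \<Rightarrow> real) \<Rightarrow> (real \<Rightarrow> real) \<Rightarrow> (real \<Rightarrow> real) \<Rightarrow> real \<Rightarrow> ereal \<Rightarrow> (real \<Rightarrow> real) \<Rightarrow> bool"
where
  "solves_on a b g x0 T y \<longleftrightarrow>
     y 0 = x0 \<and>
     continuous_on {t. 0 \<le> t \<and> ereal t < T} y \<and>
     (\<forall>t>0. ereal t < T \<longrightarrow>
        0 \<le> y t + g t \<and>
        (y has_real_derivative a t * b (y t + g t)) (at t))"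

text \<open>
  Maximal means that the solution has no extension to a longer interval \<open>[0, T')\<close>. The value
  \<open>\<infinity>\<close> is assigned from the end of the interval of existence on. Only the values of \<open>Y\<close> on
  \<open>[0, \<infinity>)\<close> matter.
\<close>

definition maximal_solution ::
  "(real \<Rightarrow> real) \<Rightarrow> (real \<Rightarrow> real) \<Rightarrow> (real \<Rightarrow> real) \<Rightarrow> real \<Rightarrow> (real \<Rightarrow> ereal) \<Rightarrow> bool"
where
  "maximal_solution a b g x0 Y \<longleftrightarrow>
     (\<exists>T y. 0 < T \<and> solves_on a b g x0 T y \<and>
        \<not> (\<exists>T' z. T < T' \<and> solves_on a b g x0 T' z \<and>
               (\<forall>t\<ge>0. ereal t < T \<longrightarrow> z t = y t)) \<and>
        (\<forall>t\<ge>0. Y t = (if ereal t < T then ereal (y t) else \<infinity>)))"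

definition explosion_time :: "(real \<Rightarrow> ereal) \<Rightarrow> ereal" where
  "explosion_time Y = (SUP t\<in>{t. 0 \<le> t \<and> Y t < \<infinity>}. ereal t)"

definition sol_inv :: "(real \<Rightarrow> ereal) \<Rightarrow> real \<Rightarrow> real" where
  "sol_inv Y s = the_inv_into {t. 0 \<le> t \<and> ereal t < explosion_time Y} Y (ereal s)"

definition A_fun :: "(real \<Rightarrow> real) \<Rightarrow> real \<Rightarrow> real" where
  "A_fun a t = integral {0..t} a"

definition Bbar ::
  "(real \<Rightarrow> real) \<Rightarrow> (real \<Rightarrow> real) \<Rightarrow> real \<Rightarrow> (real \<Rightarrow> ereal) \<Rightarrow> real \<Rightarrow> real"
where
  "Bbar b g x0 Y y = integral {x0..y} (\<lambda>s. 1 / b (s + g (sol_inv Y s)))"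

definition at_infty :: "(real \<Rightarrow> real) \<Rightarrow> ereal" where
  "at_infty F = Lim at_top (\<lambda>t. ereal (F t))"

text \<open>Inverse of \<open>A\<close> on \<open>[0, \<infinity>]\<close>, with the convention that it is \<open>\<infinity>\<close> from \<open>A(\<infinity>)\<close> on.\<close>

definition A_inv :: "(real \<Rightarrow> real) \<Rightarrow> ereal \<Rightarrow> ereal" where
  "A_inv a s =
     (if at_infty (A_fun a) \<le> s then \<infinity>
      else ereal (the_inv_into {0..} (A_fun a) (real_of_ereal s)))"

end

theory Submission
  imports Defs
begin

text \<open>
  On the interval of existence, dividing the equation by \<open>b (Y + g)\<close> and substituting \<open>s = Y u\<close>,
  so that \<open>u\<close> is the inverse of \<open>Y\<close> at \<open>s\<close>, gives \<open>Bbar (Y t) = A t\<close>. As \<open>Y\<close> is onto, this determines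
  \<open>Y t\<close>. If the explosion time \<open>T\<close> is finite, letting \<open>t\<close> tend to \<open>T\<close> gives \<open>Bbar \<infinity> = A T < A \<infinity>\<close>, so
  the times admitted in the theorem are exactly those before \<open>T\<close>.
\<close>

text \<open>\<open>Lim\<close> has a known value only once convergence is shown. Monotonicity
  supplies it: in \<open>ereal\<close> the supremum always exists, and the values eventually exceed
  every smaller bound.\<close>

lemma at_infty_mono:
  assumes "mono F"
  shows "at_infty F = (SUP t. ereal (F t))"
  unfolding at_infty_def
proof (rule tendsto_Lim)
  show "((\<lambda>t. ereal (F t)) \<longlongrightarrow> (SUP t. ereal (F t))) at_top"
  proof (rule increasing_tendsto)
    fix z assume "z < (SUP t. ereal (F t))"
    then obtain t where "z < ereal (F t)"
      by (auto simp: less_SUP_iff)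
    then have "z < ereal (F s)" if "t \<le> s" for s
      using monoD[OF assms that] by (meson ereal_less_eq(3) less_le_trans)
    then show "\<forall>\<^sub>F s in at_top. z < ereal (F s)"
      using eventually_at_top_linorder by blast
  qed (intro always_eventually allI SUP_upper UNIV_I)
qed simp

context
  fixes a :: "real \<Rightarrow> real"
  assumes cont_a: "continuous_on {0..} a" and a_pos: "\<And>t. 0 \<le> t \<Longrightarrow> 0 < a t"
begin

lemma A_fun_strict_mono: "strict_mono_on {0..} (A_fun a)"
proof (rule strict_mono_onI)
  fix s t :: real assume st: "s \<in> {0..}" "t \<in> {0..}" "s < t"
  have cont: "continuous_on {u..v} a" if "0 \<le> u" for u v
    using that by (intro continuous_on_subset[OF cont_a]) auto
  have "integral {s..t} (\<lambda>_. 0) < integral {s..t} a"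
    using st by (intro integral_less_real cont) (auto intro!: a_pos)
  moreover have "integral {0..s} a + integral {s..t} a = integral {0..t} a"
    using st by (intro Henstock_Kurzweil_Integration.integral_combine integrable_continuous_real cont) auto
  ultimately show "A_fun a s < A_fun a t"
    by (simp add: A_fun_def)
qed

text \<open>Monotonicity is needed on the whole line to apply \<open>at_infty_mono\<close>. It
  extends to negative arguments because there the interval of integration is empty and the integral
  is 0.\<close>

lemma mono_A_fun: "mono (A_fun a)"
proof (rule monoI)
  fix s t :: real assume "s \<le> t"
  have neg: "A_fun a u = A_fun a 0" if "u \<le> 0" for u
    using that by (cases "u = 0") (auto simp: A_fun_def)
  have mono: "A_fun a u \<le> A_fun a v" if "0 \<le> u" "u \<le> v" for u v
    using strict_mono_on_leD[OF A_fun_strict_mono, of u v] that by simp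
  show "A_fun a s \<le> A_fun a t"
    using \<open>s \<le> t\<close> neg[of s] neg[of t] mono[of s t] mono[of 0 t] by linarith
qed

lemma isCont_A_fun:
  assumes "0 < t"
  shows "isCont (A_fun a) t"
proof (rule continuous_on_interior)
  \<comment> \<open>The interval reaches beyond \<open>t\<close>, so that \<open>t\<close> is an
    interior point of it.\<close>
  show "continuous_on {0..t + 1} (A_fun a)"
    unfolding A_fun_def
    by (intro indefinite_integral_continuous_1 integrable_continuous_real
        continuous_on_subset[OF cont_a]) auto
qed (use assms in auto)

text \<open>Since \<open>A_fun a\<close> still grows after \<open>r\<close>, its value at
  \<open>r\<close> lies strictly below its limit, and the infinite branch of \<open>A_inv\<close> is
  not taken.\<close>

lemma A_inv_A_fun:
  assumes "0 \<le> r"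
  shows "A_inv a (ereal (A_fun a r)) = ereal r"
proof -
  have "ereal (A_fun a r) < ereal (A_fun a (r + 1))"
    using strict_mono_onD[OF A_fun_strict_mono, of r "r + 1"] assms by simp
  also have "\<dots> \<le> at_infty (A_fun a)"
    unfolding at_infty_mono[OF mono_A_fun] by (rule SUP_upper) simp
  finally have "\<not> at_infty (A_fun a) \<le> ereal (A_fun a r)"
    by simp
  moreover have "the_inv_into {0..} (A_fun a) (A_fun a r) = r"
    using assms by (intro the_inv_into_f_f strict_mono_on_imp_inj_on A_fun_strict_mono) simp
  ultimately show ?thesis
    by (simp add: A_inv_def)
qed

end

text \<open>The derivative is positive because \<open>solves_on\<close> keeps the argument of
  \<open>b\<close> nonnegative. The equation says nothing at time 0, where continuity
  suffices.\<close>

lemma solves_on_strict_mono: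
  assumes a: "\<And>t. 0 \<le> t \<Longrightarrow> 0 < a t" and b: "\<And>t. 0 \<le> t \<Longrightarrow> 0 < b t"
    and sol: "solves_on a b g x0 T y"
  shows "strict_mono_on {t. 0 \<le> t \<and> ereal t < T} y"
proof (rule strict_mono_onI)
  fix s t assume st: "s \<in> {t. 0 \<le> t \<and> ereal t < T}" "t \<in> {t. 0 \<le> t \<and> ereal t < T}" "s < t"
  have lt: "ereal u < T" if "u \<le> t" for u
    using that st(2) by (auto intro: le_less_trans[of _ "ereal t"])
  show "y s < y t"
  proof (rule DERIV_pos_imp_increasing_open[OF \<open>s < t\<close>])
    fix u assume "s < u" "u < t"
    then have u: "0 < u" "ereal u < T"
      using st lt by auto
    then have "0 \<le> y u + g u" "(y has_real_derivative a u * b (y u + g u)) (at u)"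
      using sol by (auto simp: solves_on_def)
    then show "\<exists>d. (y has_real_derivative d) (at u) \<and> 0 < d"
      using a[of u] b u by (intro exI[of _ "a u * b (y u + g u)"]) auto
  next
    have "{s..t} \<subseteq> {t. 0 \<le> t \<and> ereal t < T}"
      using st lt by auto
    then show "continuous_on {s..t} y"
      using sol continuous_on_subset unfolding solves_on_def by blast
  qed
qed

lemma explosion_time_eq:
  assumes "0 < T" and Y: "\<And>t. 0 \<le> t \<Longrightarrow> Y t = (if ereal t < T then ereal (y t) else \<infinity>)"
  shows "explosion_time Y = T"
  unfolding explosion_time_def
proof (rule SUP_eqI)
  show "ereal t \<le> T" if "t \<in> {t. 0 \<le> t \<and> Y t < \<infinity>}" for t
    using that Y by (auto split: if_splits)
next
  fix z assume z: "\<And>t. t \<in> {t. 0 \<le> t \<and> Y t < \<infinity>} \<Longrightarrow> ereal t \<le> z"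
  show "T \<le> z"
  proof (rule ccontr)
    assume "\<not> T \<le> z"
    \<comment> \<open>The maximum with 0 makes the witness nonnegative even if \<open>z\<close> is
      negative.\<close>
    then obtain t where t: "max 0 z < ereal t" "ereal t < T"
      using ereal_dense2[of "max 0 z" T] \<open>0 < T\<close> by (metis max_less_iff_conj not_le)
    then have "0 \<le> t" by simp
    with t Y have "t \<in> {t. 0 \<le> t \<and> Y t < \<infinity>}" by auto
    from z[OF this] t(1) show False by auto
  qed
qed

lemma Bbar_solution:
  assumes b: "continuous_on {0..} b" "\<And>t. 0 \<le> t \<Longrightarrow> 0 < b t"
    and g: "continuous_on {0..} g" "\<And>t. 0 \<le> t \<Longrightarrow> 0 \<le> g t"
    and "0 < x0"
    and sol: "solves_on a b g x0 T y"
    and mono: "strict_mono_on {t. 0 \<le> t \<and> ereal t < T} y"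
    and inv: "\<And>t. 0 \<le> t \<Longrightarrow> ereal t < T \<Longrightarrow> sol_inv Y (y t) = t"
    and t: "0 \<le> t" "ereal t < T"
  shows "Bbar b g x0 Y (y t) = A_fun a t"
proof -
  have lt: "ereal u < T" if "u \<le> t" for u
    using that t(2) by (auto intro: le_less_trans[of _ "ereal t"])
  have y0: "y 0 = x0"
    using sol by (simp add: solves_on_def)
  have cont: "continuous_on {0..t} y"
    using sol lt by (auto simp: solves_on_def intro: continuous_on_subset)
  have le: "y u \<le> y v" if "0 \<le> u" "u \<le> v" "v \<le> t" for u v
    using strict_mono_on_leD[OF mono, of u v] that lt by auto
  have im: "y ` {0..t} = {x0..y t}"
  proof
    show "y ` {0..t} \<subseteq> {x0..y t}"
      using le[of 0] le[of _ t] y0 by auto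
    show "{x0..y t} \<subseteq> y ` {0..t}"
      using IVT'[of y 0 _ t] t(1) cont y0 by fastforce
  qed
  define h where "h s = 1 / b (s + g (sol_inv Y s))" for s
  \<comment> \<open>The inverse of a continuous injection on a compact set is continuous; this is
    why the argument stays on \<open>{0..t}\<close> rather than on the whole interval of
    existence.\<close>
  have inv_cont: "continuous_on {x0..y t} (sol_inv Y)"
    unfolding im[symmetric] using cont lt by (intro continuous_on_inv) (auto intro: inv)
  have inv_im: "sol_inv Y s \<in> {0..}" if "s \<in> {x0..y t}" for s
    using that inv lt unfolding im[symmetric] by auto
  \<comment> \<open>Positivity of \<open>x0\<close> and nonnegativity of \<open>g\<close> keep the
    argument in the half-line on which \<open>b\<close> is continuous and positive.\<close>
  have arg: "0 \<le> s + g (sol_inv Y s)" if "s \<in> {x0..y t}" for s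
    using that inv_im[OF that] g(2)[of "sol_inv Y s"] \<open>0 < x0\<close> by auto
  have "continuous_on {x0..y t} (\<lambda>s. b (s + g (sol_inv Y s)))"
  proof (intro continuous_on_compose2[OF b(1)] continuous_intros)
    show "continuous_on {x0..y t} (\<lambda>s. g (sol_inv Y s))"
      by (rule continuous_on_compose2[OF g(1) inv_cont]) (use inv_im in auto)
  qed (use arg in auto)
  moreover have "b (s + g (sol_inv Y s)) \<noteq> 0" if "s \<in> {x0..y t}" for s
    using b(2)[OF arg[OF that]] by simp
  ultimately have h_cont: "continuous_on {x0..y t} h"
    unfolding h_def by (intro continuous_intros) auto
  \<comment> \<open>The point 0, where no derivative is given, becomes the finite exceptional set in
    the substitution rule.\<close>
  have deriv: "(y has_real_derivative a u * b (y u + g u)) (at u within {0..t})"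
    if "u \<in> {0..t} - {0}" for u
    using sol that lt by (auto simp: solves_on_def intro: has_field_derivative_at_within)
  have "((\<lambda>u. (a u * b (y u + g u)) *\<^sub>R h (y u)) has_integral integral {y 0..y t} h) {0..t}"
    using im le[of 0 t] t(1)
    by (intro has_integral_substitution_strong[of "{0}", OF _ _ _ _ h_cont cont deriv]) auto
  moreover have "(a u * b (y u + g u)) *\<^sub>R h (y u) = a u" if "u \<in> {0..t}" for u
  proof -
    have "y u \<in> {x0..y t}" "sol_inv Y (y u) = u"
      using that im inv lt by auto
    then have "0 < b (y u + g u)"
      using b(2)[OF arg[of "y u"]] by simp
    then show ?thesis
      using \<open>sol_inv Y (y u) = u\<close> by (simp add: h_def)
  qed
  ultimately have "(a has_integral integral {y 0..y t} h) {0..t}"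
    by (rule has_integral_eq[rotated])
  then show ?thesis
    unfolding Bbar_def A_fun_def h_def[abs_def, symmetric] y0 by (simp add: integral_unique)
qed

theorem corollary3:
  fixes a b g :: "real \<Rightarrow> real" and x0 :: real and Y :: "real \<Rightarrow> ereal"
  assumes "continuous_on {0..} a" and "\<And>t. 0 \<le> t \<Longrightarrow> 0 < a t"
    and "continuous_on {0..} b" and "\<And>t. 0 \<le> t \<Longrightarrow> 0 < b t"
    and "continuous_on {0..} g" and "\<And>t. 0 \<le> t \<Longrightarrow> 0 \<le> g t"
    and "0 < x0"
    and "maximal_solution a b g x0 Y"
    and "Y ` {t. 0 \<le> t \<and> ereal t < explosion_time Y} = ereal ` {x0..}"
  shows "\<forall>t\<ge>0. ereal t < A_inv a (at_infty (Bbar b g x0 Y)) \<longrightarrow>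
           A_fun a t \<in> Bbar b g x0 Y ` {x0..} \<and>
           Y t = ereal (the_inv_into {x0..} (Bbar b g x0 Y) (A_fun a t))"
proof -
  obtain T y where "0 < T" and sol: "solves_on a b g x0 T y"
    and Y: "\<And>t. 0 \<le> t \<Longrightarrow> Y t = (if ereal t < T then ereal (y t) else \<infinity>)"
    using assms(8) unfolding maximal_solution_def by blast
  define D where "D = {t. 0 \<le> t \<and> ereal t < T}"
  have expl: "explosion_time Y = T"
    using \<open>0 < T\<close> Y by (rule explosion_time_eq)
  have mono: "strict_mono_on D y"
    unfolding D_def using assms(2,4) sol by (rule solves_on_strict_mono)
  have YD: "Y t = ereal (y t)" if "t \<in> D" for t
    using that Y by (simp add: D_def)
  have im: "y ` D = {x0..}"
  proof -
    have "ereal ` (y ` D) = ereal ` {x0..}"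
      using assms(9) YD unfolding expl D_def[symmetric] by (simp add: image_image)
    then show ?thesis
      by (simp add: inj_image_eq_iff inj_def)
  qed
  have inv: "sol_inv Y (y t) = t" if "t \<in> D" for t
  proof -
    have "inj_on Y D"
      using strict_mono_on_imp_inj_on[OF mono] YD by (auto simp: inj_on_def)
    then show ?thesis
      unfolding sol_inv_def expl D_def[symmetric] YD[OF that, symmetric]
      using that by (rule the_inv_into_f_f)
  qed
  have Bbar_y: "Bbar b g x0 Y (y t) = A_fun a t" if "t \<in> D" for t
    using Bbar_solution[OF assms(3-7) sol mono[unfolded D_def] inv, of t] that by (simp add: D_def)
  \<comment> \<open>As \<open>y\<close> maps \<open>D\<close> onto \<open>{x0..}\<close> and
    \<open>Bbar\<close> composed with \<open>y\<close> is \<open>A_fun a\<close> on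
    \<open>D\<close>, injectivity carries over from \<open>A_fun a\<close>.\<close>
  have inj: "inj_on (Bbar b g x0 Y) {x0..}"
  proof -
    have "inj_on (A_fun a) D"
      using strict_mono_on_imp_inj_on[OF A_fun_strict_mono[OF assms(1,2)]]
      by (rule inj_on_subset) (auto simp: D_def)
    then show ?thesis
      unfolding im[symmetric] by (auto simp: inj_on_def Bbar_y)
  qed
  have in_D: "t \<in> D" if "0 \<le> t" and less: "ereal t < A_inv a (at_infty (Bbar b g x0 Y))" for t
  proof (cases T)
    case (real r)
    have "0 < r"
      using \<open>0 < T\<close> real by simp
    have inv_im: "sol_inv Y x \<in> D" "y (sol_inv Y x) = x" if "x0 \<le> x" for x
      using that inv im by (force simp: image_iff)+
    \<comment> \<open>The limit of \<open>Bbar\<close> is found by writing it as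
      \<open>A_fun a\<close> composed with \<open>sol_inv Y\<close>. The inverse takes values in
      \<open>D\<close>, hence below \<open>r\<close>, and exceeds any \<open>c < r\<close> for
      arguments beyond \<open>y (max 0 c)\<close>.\<close>
    have "(sol_inv Y \<longlongrightarrow> r) at_top"
    proof (rule increasing_tendsto)
      have "sol_inv Y x \<le> r" if "x0 \<le> x" for x
        using inv_im[OF that] real by (simp add: D_def)
      then show "\<forall>\<^sub>F x in at_top. sol_inv Y x \<le> r"
        by (auto simp: eventually_at_top_linorder)
    next
      fix c assume "c < r"
      define u where "u = max 0 c"
      have u: "u \<in> D"
        using \<open>c < r\<close> \<open>0 < r\<close> real by (auto simp: u_def D_def)
      then have "x0 \<le> y u"
        using im by blast
      have "c < sol_inv Y x" if "y u < x" for x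
      proof -
        have "u < sol_inv Y x"
          using strict_mono_on_less[OF mono u inv_im(1), of x] inv_im(2)[of x] \<open>x0 \<le> y u\<close> that
          by simp
        then show ?thesis by (simp add: u_def)
      qed
      then show "\<forall>\<^sub>F x in at_top. c < sol_inv Y x"
        by (auto simp: eventually_at_top_dense)
    qed
    \<comment> \<open>Explosion does not affect \<open>a\<close>, so \<open>A_fun a\<close> is
      continuous at \<open>r\<close> itself.\<close>
    then have "((\<lambda>x. ereal (A_fun a (sol_inv Y x))) \<longlongrightarrow> ereal (A_fun a r)) at_top"
      using isCont_A_fun[OF assms(1,2) \<open>0 < r\<close>]
      by (intro tendsto_intros isCont_tendsto_compose[of r "A_fun a"])
    moreover have "A_fun a (sol_inv Y x) = Bbar b g x0 Y x" if "x0 \<le> x" for x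
      using Bbar_y[of "sol_inv Y x"] inv_im[OF that] by simp
    then have "\<forall>\<^sub>F x in at_top. ereal (A_fun a (sol_inv Y x)) = ereal (Bbar b g x0 Y x)"
      by (auto simp: eventually_at_top_linorder)
    ultimately have "((\<lambda>x. ereal (Bbar b g x0 Y x)) \<longlongrightarrow> ereal (A_fun a r)) at_top"
      by (rule Lim_transform_eventually)
    then have "at_infty (Bbar b g x0 Y) = ereal (A_fun a r)"
      unfolding at_infty_def by (intro tendsto_Lim) auto
    \<comment> \<open>By \<open>A_inv_A_fun\<close>, the bound on \<open>t\<close> is exactly
      \<open>r\<close>.\<close>
    with less have "ereal t < T"
      using A_inv_A_fun[OF assms(1,2), of r] \<open>0 < r\<close> real by simp
    with \<open>0 \<le> t\<close> show ?thesis by (simp add: D_def)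
  qed (use \<open>0 < T\<close> \<open>0 \<le> t\<close> in \<open>auto simp: D_def\<close>)
  show ?thesis
  proof (intro allI impI)
    fix t assume "0 \<le> t" "ereal t < A_inv a (at_infty (Bbar b g x0 Y))"
    then have t: "t \<in> D"
      by (rule in_D)
    then have y: "y t \<in> {x0..}"
      using im by blast
    show "A_fun a t \<in> Bbar b g x0 Y ` {x0..} \<and>
        Y t = ereal (the_inv_into {x0..} (Bbar b g x0 Y) (A_fun a t))"
      \<comment> \<open>Once \<open>A_fun a t\<close> is rewritten as \<open>Bbar\<close> at
        \<open>y t\<close>, the inverse cancels.\<close>
      unfolding Bbar_y[OF t, symmetric] the_inv_into_f_f[OF inj y] YD[OF t] using y by simp
  qed
qed

end
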